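(* Let $S=(v_1,\ldots,v_n)$ be an $(n,k)$-uframe and let $i\in[n]$ be such that $v_i\in\mathop{\rm co}\{\pm v_j:\ j\in[n],\,j\neq i\}$. Let $\tilde S$ be the $(n,k)$-frame obtained from $S$ by replacing $v_i$ with $0$, and let $S'=B_{\tilde S}\tilde S$. Then $$\vol\left(\mathop{\rm co}(\pm S)\right)\leqslant\vol\left(\mathop{\rm co}(\pm S')\right),$$ with equality if and only if $v_i=0$.
   Context: An $(n,k)$-frame is an ordered $n$-tuple of vectors in $\mathbb{R}^k$ spanning $\mathbb{R}^k$. For a frame $T=(w_1,\dots,w_n)$, $A_T=\sum w_j w_j^T$ (positive definite) and $B_T=A_T^{-1/2}$; $B_T T=(B_Tw_1,\dots,B_Tw_n)$, which is always an $(n,k)$-uframe. An $(n,k)$-uframe is a frame with $A_T=I_k$. For a tuple $T=(w_j)$, $\mathop{\rm co}(\pm T)=\mathop{\rm co}\{\pm w_j\}$. $\vol$ is $k$-dimensional volume. *)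

theory Defs
  imports "HOL-Analysis.Analysis"
begin

text \<open>A tuple of n vectors in R^k is a function from nat, with indices 0..n-1 used.\<close>

definition frame_op :: "nat \<Rightarrow> (nat \<Rightarrow> real^'k) \<Rightarrow> real^'k^'k" where
  "frame_op n w = (\<Sum>j<n. (\<chi> a b. (w j) $ a * (w j) $ b))"

definition is_frame :: "nat \<Rightarrow> (nat \<Rightarrow> real^'k) \<Rightarrow> bool" where
  "is_frame n w \<longleftrightarrow> span (w ` {..<n}) = UNIV"

definition is_uframe :: "nat \<Rightarrow> (nat \<Rightarrow> real^'k) \<Rightarrow> bool" where
  "is_uframe n w \<longleftrightarrow> is_frame n w \<and> frame_op n w = mat 1"

definition pos_def_mat :: "real^'k^'k \<Rightarrow> bool" where
  "pos_def_mat M \<longleftrightarrow> transpose M = M \<and> (\<forall>x. x \<noteq> 0 \<longrightarrow> x \<bullet> (M *v x) > 0)"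

text \<open>A^{-1/2}: the unique positive definite matrix whose square is the inverse of A.\<close>
definition inv_sqrt_mat :: "real^'k^'k \<Rightarrow> real^'k^'k" where
  "inv_sqrt_mat A = (THE B. pos_def_mat B \<and> B ** B = matrix_inv A)"

definition B_frame :: "nat \<Rightarrow> (nat \<Rightarrow> real^'k) \<Rightarrow> real^'k^'k" where
  "B_frame n w = inv_sqrt_mat (frame_op n w)"

definition normalize_frame :: "nat \<Rightarrow> (nat \<Rightarrow> real^'k) \<Rightarrow> (nat \<Rightarrow> real^'k)" where
  "normalize_frame n w = (\<lambda>j. B_frame n w *v w j)"

definition sym_hull :: "nat \<Rightarrow> (nat \<Rightarrow> real^'k) \<Rightarrow> (real^'k) set" where
  "sym_hull n w = convex hull (w ` {..<n} \<union> (\<lambda>j. - w j) ` {..<n})"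

end

theory Submission
  imports Defs
begin

text \<open>
  Write \<open>u = v i\<close> and \<open>t = u \<bullet> u\<close>. Since \<open>u\<close> and \<open>-u\<close> lie in the convex hull of the
  remaining \<open>\<plusminus>v j\<close>, and hence so does \<open>0\<close>, replacing \<open>v i\<close> by \<open>0\<close> does not change the
  symmetric hull. The frame operator of the new frame is \<open>I - u u\<^sup>T\<close>, so \<open>B\<close> is the rank-one
  update of the identity that fixes \<open>u\<^sup>\<bottom>\<close> and stretches \<open>u\<close> by \<open>1 / sqrt (1 - t)\<close>; the
  volume is multiplied by this factor, which is at least 1, with equality iff \<open>u = 0\<close>.
  That \<open>t < 1\<close> comes from Parseval: \<open>t = t\<^sup>2 + (\<Sum>j\<noteq>i. (v j \<bullet> u)\<^sup>2)\<close>, so \<open>t \<ge> 1\<close> would make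
  all other \<open>v j\<close> orthogonal to \<open>u\<close>, and then \<open>u\<close>, lying in their hull, would vanish.
  The volume is positive because the hull of a frame is full-dimensional.
\<close>

section \<open>Lebesgue measure of linear images\<close>

text \<open>
  The library proves \<open>measure_linear_image\<close> only for wellordered index types; the order is
  used solely to compute the determinant of a shear, which \<open>det_row_span\<close> does without it.
  So the induction over elementary maps is redone here for any finite index type.
\<close>

definition det_scales_measure :: "(real^'n \<Rightarrow> real^'n) \<Rightarrow> bool" where
  "det_scales_measure f \<longleftrightarrow> (\<forall>S \<in> lmeasurable. f ` S \<in> lmeasurable \<and>
     measure lebesgue (f ` S) = \<bar>det (matrix f)\<bar> * measure lebesgue S)"

lemma det_scales_measure_comp:
  fixes f g :: "real^'n \<Rightarrow> real^'n"
  assumes "linear f" "linear g" "det_scales_measure f" "det_scales_measure g"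
  shows "det_scales_measure (f \<circ> g)"
  unfolding det_scales_measure_def
proof
  fix S :: "(real^'n) set"
  assume "S \<in> lmeasurable"
  then have g: "g ` S \<in> lmeasurable" "measure lebesgue (g ` S) = \<bar>det (matrix g)\<bar> * measure lebesgue S"
    using assms(4) by (auto simp: det_scales_measure_def)
  then have f: "f ` g ` S \<in> lmeasurable"
      "measure lebesgue (f ` g ` S) = \<bar>det (matrix f)\<bar> * measure lebesgue (g ` S)"
    using assms(3) by (auto simp: det_scales_measure_def)
  have det: "\<bar>det (matrix (f \<circ> g))\<bar> = \<bar>det (matrix f)\<bar> * \<bar>det (matrix g)\<bar>"
    by (simp add: matrix_compose[OF assms(2,1)] det_mul abs_mult)
  have eq: "(f \<circ> g) ` S = f ` g ` S"
    by (simp only: image_comp)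
  have "measure lebesgue ((f \<circ> g) ` S) = \<bar>det (matrix (f \<circ> g))\<bar> * measure lebesgue S"
    by (simp only: eq f(2) g(2) det mult.assoc)
  with f(1) show "(f \<circ> g) ` S \<in> lmeasurable \<and>
      measure lebesgue ((f \<circ> g) ` S) = \<bar>det (matrix (f \<circ> g))\<bar> * measure lebesgue S"
    unfolding eq by blast
qed

lemma det_scales_measure_singular:
  assumes "linear f" "\<not> inj f"
  shows "det_scales_measure f"
proof -
  have "det (matrix f) = 0"
    using assms det_nz_iff_inj by blast
  moreover have "negligible (f ` S)" for S
    using assms negligible_linear_singular_image by blast
  ultimately show ?thesis
    by (simp add: det_scales_measure_def negligible_imp_measure0 negligible_imp_measurable)
qed

lemma det_scales_measure_stretch: "det_scales_measure (\<lambda>x. \<chi> i. c i * x$i)"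
  by (simp add: det_scales_measure_def measurable_stretch measure_stretch matrix_def axis_def
      det_diagonal)

definition shear :: "'n \<Rightarrow> 'n \<Rightarrow> real^'n \<Rightarrow> real^'n" where
  "shear m n x = (\<chi> i. if i = m then x$m + x$n else x$i)"

lemma linear_shear: "linear (shear m n)"
  by (rule linearI) (auto simp: shear_def vec_eq_iff algebra_simps)

lemma det_shear:
  fixes m n :: "'n::finite"
  assumes "m \<noteq> n"
  shows "det (matrix (shear m n)) = 1"
proof -
  have eq: "matrix (shear m n)
      = (\<chi> k. if k = m then row m (mat 1) + row n (mat 1) else row k (mat 1 :: real^'n^'n))"
    by (auto simp: vec_eq_iff matrix_def axis_def row_def mat_def shear_def)
  have "row n (mat 1 :: real^'n^'n) \<in> vec.span {row j (mat 1) |j. j \<noteq> m}"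
    using assms by (intro vec.span_base) blast
  from det_row_span[OF this] show ?thesis by (simp add: eq)
qed

lemma measure_shear_cbox:
  assumes "m \<noteq> n"
  shows "measure lebesgue (shear m n ` cbox a b) = measure lebesgue (cbox a b)"
proof (cases "cbox a b = {}")
  case False
  \<comment> \<open>translate to the origin to meet the hypothesis \<open>0 \<le> a$n\<close> of \<open>measure_shear_interval\<close>\<close>
  have ab: "cbox a b = (+) a ` cbox 0 (b - a)"
    using cbox_translation[of a 0 "b - a"] by simp
  then have "cbox 0 (b - a) \<noteq> {}"
    using False by blast
  have "shear m n ` cbox a b = (+) (shear m n a) ` (shear m n ` cbox 0 (b - a))"
    by (simp add: ab image_comp o_def linear_add[OF linear_shear])
  then have "measure lebesgue (shear m n ` cbox a b) = measure lebesgue (shear m n ` cbox 0 (b - a))"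
    by (simp add: measure_translation)
  also have "\<dots> = measure lebesgue (cbox 0 (b - a))"
    using measure_shear_interval[OF assms \<open>cbox 0 (b - a) \<noteq> {}\<close>] by (simp add: shear_def)
  also have "\<dots> = measure lebesgue (cbox a b)"
    by (simp add: ab measure_translation)
  finally show ?thesis .
qed simp

lemma det_scales_measure_shear:
  fixes m n :: "'n::finite"
  assumes "m \<noteq> n"
  shows "det_scales_measure (shear m n)"
  unfolding det_scales_measure_def det_shear[OF assms]
proof
  fix S :: "(real^'n) set"
  assume "S \<in> lmeasurable"
  have "shear m n ` S \<in> lmeasurable \<and> 1 * measure lebesgue S = measure lebesgue (shear m n ` S)"
    by (rule measure_linear_sufficient[OF linear_shear \<open>S \<in> lmeasurable\<close>])
      (simp add: measure_shear_cbox[OF assms])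
  then show "shear m n ` S \<in> lmeasurable \<and> measure lebesgue (shear m n ` S) = \<bar>1\<bar> * measure lebesgue S"
    by simp
qed

lemma linear_stretch: "linear (\<lambda>x::real^'n. \<chi> i. c i * x$i)"
  by (rule linearI) (simp_all add: vec_eq_iff algebra_simps)

text \<open>In coordinates \<open>(m, n)\<close>: \<open>(x, y) \<mapsto> (x+y, y) \<mapsto> (x+y, -y) \<mapsto> (x+y, x) \<mapsto> (x+y, -x) \<mapsto> (y, -x) \<mapsto> (y, x)\<close>.\<close>

lemma swap_eq_shears:
  fixes m n :: "'n::finite"
  defines "N \<equiv> \<lambda>x::real^'n. \<chi> i. (if i = n then -1 else 1) * x$i"
  assumes "m \<noteq> n"
  shows "(\<lambda>x. \<chi> i. x $ Transposition.transpose m n i)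
    = N \<circ> shear m n \<circ> N \<circ> shear n m \<circ> N \<circ> shear m n"
  using assms by (auto simp: fun_eq_iff vec_eq_iff shear_def N_def Transposition.transpose_def)

lemma det_scales_measure_swap:
  fixes m n :: "'n::finite"
  assumes "m \<noteq> n"
  shows "det_scales_measure (\<lambda>x::real^'n. \<chi> i. x $ Transposition.transpose m n i)"
  unfolding swap_eq_shears[OF assms]
  using assms
  by (intro det_scales_measure_comp linear_compose linear_shear linear_stretch
      det_scales_measure_shear det_scales_measure_stretch) auto

theorem det_scales_measure_linear:
  fixes f :: "real^'n \<Rightarrow> real^'n"
  assumes "linear f"
  shows "det_scales_measure f"
proof (rule induct_linear_elementary[OF assms])
  show "det_scales_measure (f \<circ> g)"
    if "linear f" "linear g" "det_scales_measure f" "det_scales_measure g"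
    for f g :: "real^'n \<Rightarrow> real^'n"
    using that by (rule det_scales_measure_comp)
  show "det_scales_measure f" if "linear f" "\<And>x. f x $ i = 0" for f :: "real^'n \<Rightarrow> real^'n" and i
  proof (rule det_scales_measure_singular[OF \<open>linear f\<close>])
    show "\<not> inj f"
      using that by (metis vec_component linear_injective_imp_surjective surjE one_neq_zero)
  qed
  show "det_scales_measure (\<lambda>x. \<chi> i. c i * x$i)" for c
    by (rule det_scales_measure_stretch)
  show "det_scales_measure (\<lambda>x. \<chi> i. x $ Transposition.transpose m n i)" if "m \<noteq> n" for m n :: 'n
    using that by (rule det_scales_measure_swap)
  show "det_scales_measure (\<lambda>x. \<chi> i. if i = m then x$m + x$n else x$i)" if "m \<noteq> n" for m n :: 'n
    using det_scales_measure_shear[OF that] unfolding shear_def[abs_def] .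
qed

lemma measure_matrix_image:
  fixes A :: "real^'n^'n"
  assumes "S \<in> lmeasurable"
  shows "measure lebesgue ((*v) A ` S) = \<bar>det A\<bar> * measure lebesgue S"
  using det_scales_measure_linear[OF matrix_vector_mul_linear, of A] assms
  by (simp add: det_scales_measure_def)

section \<open>Rank-one updates of the identity\<close>

definition outer_prod :: "real^'k \<Rightarrow> real^'k^'k" where
  "outer_prod u = (\<chi> i j. u$i * u$j)"

definition rank_one_update :: "real^'k \<Rightarrow> real \<Rightarrow> real^'k^'k" where
  "rank_one_update u a = mat 1 + a *\<^sub>R outer_prod u"

lemma outer_prod_mult_vec: "outer_prod u *v x = (u \<bullet> x) *\<^sub>R u"
  by (simp add: outer_prod_def vec_eq_iff matrix_vector_mult_def inner_vec_def sum_distrib_left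
      mult.commute mult.left_commute)

lemma rank_one_update_mult_vec: "rank_one_update u a *v x = x + (a * (u \<bullet> x)) *\<^sub>R u"
  by (simp add: rank_one_update_def matrix_vector_mult_add_rdistrib outer_prod_mult_vec
      scaleR_matrix_vector_assoc[symmetric])

lemma rank_one_update_mult:
  "rank_one_update u a ** rank_one_update u b = rank_one_update u (a + b + a * b * (u \<bullet> u))"
  by (simp add: matrix_eq matrix_vector_mul_assoc[symmetric] rank_one_update_mult_vec
      inner_add_right algebra_simps)

lemma rank_one_update_zero [simp]: "rank_one_update u 0 = mat 1"
  by (simp add: rank_one_update_def)

lemma rank_one_update_zero_vec [simp]: "rank_one_update 0 a = mat 1"
  by (simp add: rank_one_update_def outer_prod_def vec_eq_iff)

lemma rank_one_update_cong:
  assumes "a * (u \<bullet> u) = b * (u \<bullet> u)"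
  shows "rank_one_update u a = rank_one_update u b"
  using assms by (cases "u = 0") simp_all

lemma rank_one_update_square:
  assumes "(1 + c * (u \<bullet> u))\<^sup>2 = 1 + d * (u \<bullet> u)"
  shows "rank_one_update u c ** rank_one_update u c = rank_one_update u d"
proof -
  have "(c + c + c * c * (u \<bullet> u)) * (u \<bullet> u) = (1 + c * (u \<bullet> u))\<^sup>2 - 1"
    by (simp add: power2_eq_square algebra_simps)
  then show ?thesis
    using assms by (simp add: rank_one_update_mult rank_one_update_cong)
qed

lemma pos_def_rank_one_update:
  fixes u :: "real^'k"
  assumes "1 + a * (u \<bullet> u) > 0"
  shows "pos_def_mat (rank_one_update u a)"
  unfolding pos_def_mat_def
proof (intro conjI allI impI)
  show "transpose (rank_one_update u a) = rank_one_update u a"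
    by (simp add: rank_one_update_def outer_prod_def transpose_def vec_eq_iff mat_def mult.commute)
  fix x :: "real^'k"
  assume "x \<noteq> 0"
  have "min a 0 * (u \<bullet> u) * (x \<bullet> x) \<le> a * (u \<bullet> x)\<^sup>2"
  proof (cases "a \<ge> 0")
    case False
    then show ?thesis
      using mult_left_mono_neg[OF Cauchy_Schwarz_ineq[of u x], of a] by (simp add: mult.assoc)
  qed simp
  moreover have "1 + min a 0 * (u \<bullet> u) > 0"
    using assms by (cases "a \<ge> 0") auto
  then have "0 < (1 + min a 0 * (u \<bullet> u)) * (x \<bullet> x)"
    using \<open>x \<noteq> 0\<close> by simp
  then have "0 < x \<bullet> x + min a 0 * (u \<bullet> u) * (x \<bullet> x)"
    by (simp add: distrib_right)
  moreover have "x \<bullet> (rank_one_update u a *v x) = x \<bullet> x + a * (u \<bullet> x)\<^sup>2"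
    by (simp add: rank_one_update_mult_vec inner_add_right power2_eq_square inner_commute)
  ultimately show "x \<bullet> (rank_one_update u a *v x) > 0"
    by linarith
qed

lemma orthogonal_conj_rank_one_update:
  assumes "orthogonal_matrix Q"
  shows "Q ** rank_one_update u a ** transpose Q = rank_one_update (Q *v u) a"
  unfolding matrix_eq
proof
  fix x
  have "u \<bullet> (x v* Q) = (Q *v u) \<bullet> x"
    by (metis dot_lmul_matrix inner_commute)
  then have "(Q ** rank_one_update u a ** transpose Q) *v x
      = (Q ** transpose Q) *v x + (a * ((Q *v u) \<bullet> x)) *\<^sub>R (Q *v u)"
    by (simp add: matrix_vector_mul_assoc[symmetric] rank_one_update_mult_vec
        matrix_vector_right_distrib matrix_vector_mult_scaleR)
  also have "\<dots> = rank_one_update (Q *v u) a *v x"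
    using assms by (simp add: orthogonal_matrix_def rank_one_update_mult_vec)
  finally show "(Q ** rank_one_update u a ** transpose Q) *v x = rank_one_update (Q *v u) a *v x" .
qed

lemma det_rank_one_update:
  fixes u :: "real^'k"
  shows "det (rank_one_update u a) = 1 + a * (u \<bullet> u)"
proof -
  \<comment> \<open>conjugating by a rotation that maps \<open>u\<close> onto a coordinate axis makes the matrix diagonal\<close>
  obtain m :: 'k where True by blast
  let ?e = "norm u *\<^sub>R axis m (1::real)"
  obtain f where f: "orthogonal_transformation f" "f u = ?e"
    using orthogonal_transformation_exists[of u ?e] by auto
  define Q where "Q = matrix f"
  have Q: "orthogonal_matrix Q" "Q *v u = ?e"
    using f orthogonal_transformation_matrix orthogonal_transformation_linear matrix_works
    by (fastforce simp: Q_def)+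
  have "det Q * det Q = 1"
    using det_orthogonal_matrix[OF Q(1)] by auto
  then have "det (rank_one_update u a) = det (Q ** rank_one_update u a ** transpose Q)"
    by (simp add: det_mul det_transpose algebra_simps)
  also have "\<dots> = (\<Prod>i\<in>UNIV. rank_one_update ?e a $ i $ i)"
    unfolding orthogonal_conj_rank_one_update[OF Q(1)] Q(2)
    by (rule det_diagonal) (auto simp: rank_one_update_def outer_prod_def mat_def axis_def)
  also have "\<dots> = (\<Prod>i\<in>UNIV. if i = m then 1 + a * (u \<bullet> u) else 1)"
    by (rule prod.cong) (auto simp: rank_one_update_def outer_prod_def mat_def axis_def
        power2_norm_eq_inner[symmetric] power2_eq_square)
  finally show ?thesis
    by simp
qed

lemma pos_def_sqrt_eigenvector:
  fixes B :: "real^'k^'k"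
  assumes "pos_def_mat B" "(B ** B) *v x = s\<^sup>2 *\<^sub>R x" "s > 0"
  shows "B *v x = s *\<^sub>R x"
proof (rule ccontr)
  define y where "y = B *v x - s *\<^sub>R x"
  assume "B *v x \<noteq> s *\<^sub>R x"
  then have "y \<noteq> 0"
    by (simp add: y_def)
  have "B *v y = - s *\<^sub>R y"
    using assms(2)
    by (simp add: y_def matrix_vector_mult_diff_distrib matrix_vector_mult_scaleR
        matrix_vector_mul_assoc algebra_simps power2_eq_square)
  then have "y \<bullet> (B *v y) = - s * (y \<bullet> y)"
    by simp
  moreover have "y \<bullet> (B *v y) > 0"
    using \<open>y \<noteq> 0\<close> assms(1) by (simp add: pos_def_mat_def)
  moreover have "s * (y \<bullet> y) > 0"
    using \<open>y \<noteq> 0\<close> \<open>s > 0\<close> by simp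
  ultimately show False
    by linarith
qed

lemma matrix_eqI_orthogonal_split:
  fixes A B :: "real^'k^'k"
  assumes "A *v u = B *v u" "\<And>y. u \<bullet> y = 0 \<Longrightarrow> A *v y = B *v y"
  shows "A = B"
  unfolding matrix_eq
proof
  fix x
  define c where "c = (u \<bullet> x) / (u \<bullet> u)"
  have "u \<bullet> (x - c *\<^sub>R u) = 0"
    by (cases "u = 0") (simp_all add: c_def inner_diff_right)
  then have "A *v (x - c *\<^sub>R u) = B *v (x - c *\<^sub>R u)"
    by (rule assms(2))
  with assms(1) show "A *v x = B *v x"
    by (simp add: matrix_vector_mult_diff_distrib matrix_vector_mult_scaleR)
qed

lemma matrix_inv_unique:
  fixes A :: "'a::semiring_1^'n^'n"
  assumes "A ** X = mat 1" "X ** A = mat 1"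
  shows "matrix_inv A = X"
proof -
  have "A ** matrix_inv A = mat 1 \<and> matrix_inv A ** A = mat 1"
    unfolding matrix_inv_def using assms by (rule someI[where x = X, OF conjI])
  then have "matrix_inv A = matrix_inv A ** (A ** X)"
    by (simp add: assms)
  also have "\<dots> = X"
    using \<open>A ** matrix_inv A = mat 1 \<and> matrix_inv A ** A = mat 1\<close> by (simp add: matrix_mul_assoc)
  finally show ?thesis .
qed

lemma pos_def_sqrt_rank_one_update_unique:
  fixes B :: "real^'k^'k"
  assumes "pos_def_mat B" "B ** B = rank_one_update u d"
    and "(1 + c * (u \<bullet> u))\<^sup>2 = 1 + d * (u \<bullet> u)" "1 + c * (u \<bullet> u) > 0"
  shows "B = rank_one_update u c"
proof (rule matrix_eqI_orthogonal_split)
  have "(B ** B) *v u = (1 + c * (u \<bullet> u))\<^sup>2 *\<^sub>R u"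
    using assms(2,3) by (simp add: rank_one_update_mult_vec scaleR_add_left)
  then have "B *v u = (1 + c * (u \<bullet> u)) *\<^sub>R u"
    using pos_def_sqrt_eigenvector[OF assms(1) _ assms(4)] by blast
  then show "B *v u = rank_one_update u c *v u"
    by (simp add: rank_one_update_mult_vec scaleR_add_left)
  show "B *v y = rank_one_update u c *v y" if "u \<bullet> y = 0" for y
    using pos_def_sqrt_eigenvector[OF assms(1), of y 1] assms(2) that
    by (simp add: rank_one_update_mult_vec)
qed

lemma inv_sqrt_mat_rank_one_update:
  fixes u :: "real^'k"
  assumes "u \<bullet> u < 1" "1 + c * (u \<bullet> u) = 1 / sqrt (1 - u \<bullet> u)"
  shows "inv_sqrt_mat (rank_one_update u (-1)) = rank_one_update u c"
proof -
  define d where "d = 1 / (1 - u \<bullet> u)"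
  have d: "1 + d * (u \<bullet> u) = d"
    using assms(1) by (simp add: d_def field_simps)
  have "(1 + c * (u \<bullet> u))\<^sup>2 = d"
    using assms by (simp add: d_def power_divide)
  then have c: "(1 + c * (u \<bullet> u))\<^sup>2 = 1 + d * (u \<bullet> u)" "1 + c * (u \<bullet> u) > 0"
    using assms by (simp_all add: d)
  have "-1 + d + -1 * d * (u \<bullet> u) = 0" "d + -1 + d * -1 * (u \<bullet> u) = 0"
    using d by simp_all
  then have inv: "matrix_inv (rank_one_update u (-1)) = rank_one_update u d"
    by (intro matrix_inv_unique) (simp_all only: rank_one_update_mult rank_one_update_zero)
  show ?thesis
    unfolding inv_sqrt_mat_def inv
  proof (rule the_equality)
    show "pos_def_mat (rank_one_update u c) \<and> rank_one_update u c ** rank_one_update u c = rank_one_update u d"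
      using pos_def_rank_one_update[OF c(2)] rank_one_update_square[OF c(1)] ..
    show "B = rank_one_update u c" if "pos_def_mat B \<and> B ** B = rank_one_update u d" for B
      using that pos_def_sqrt_rank_one_update_unique[OF _ _ c] by blast
  qed
qed

section \<open>Frames and their symmetric hulls\<close>

lemma sum_matrix_vector_mult: "(\<Sum>j\<in>A. M j) *v x = (\<Sum>j\<in>A. M j *v x)"
  by (induction A rule: infinite_finite_induct) (auto simp: matrix_vector_mult_add_rdistrib)

lemma frame_op_eq_sum_outer_prod: "frame_op n w = (\<Sum>j<n. outer_prod (w j))"
  by (simp add: frame_op_def outer_prod_def)

lemma uframe_sum_inner_square:
  assumes "is_uframe n v"
  shows "(\<Sum>j<n. (v j \<bullet> x)\<^sup>2) = x \<bullet> x"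
proof -
  have "x = frame_op n v *v x"
    using assms by (simp add: is_uframe_def)
  also have "\<dots> = (\<Sum>j<n. (v j \<bullet> x) *\<^sub>R v j)"
    by (simp add: frame_op_eq_sum_outer_prod sum_matrix_vector_mult outer_prod_mult_vec)
  finally have "x \<bullet> x = x \<bullet> (\<Sum>j<n. (v j \<bullet> x) *\<^sub>R v j)"
    by simp
  then show ?thesis
    by (simp add: inner_sum_right power2_eq_square inner_commute)
qed

lemma uframe_frame_op_fun_upd_zero:
  assumes "is_uframe n v" "i < n"
  shows "frame_op n (v(i := 0)) = rank_one_update (v i) (-1)"
proof -
  have "frame_op n (v(i := 0)) + outer_prod (v i) = frame_op n v"
    using assms(2)
    by (simp add: frame_op_eq_sum_outer_prod sum.remove outer_prod_def vec_eq_iff)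
  with assms(1) show ?thesis
    by (simp add: is_uframe_def rank_one_update_def eq_diff_eq[symmetric])
qed

lemma convex_hull_orthogonal_imp_zero:
  assumes "u \<in> convex hull X" "\<And>x. x \<in> X \<Longrightarrow> u \<bullet> x = 0"
  shows "u = 0"
proof -
  have "convex hull X \<subseteq> {x. u \<bullet> x = 0}"
    using assms(2) by (intro hull_minimal convex_hyperplane) auto
  with assms(1) show ?thesis
    by auto
qed

lemma uframe_inner_self_less_one:
  assumes "is_uframe n v" "i < n"
    and "v i \<in> convex hull (v ` ({..<n} - {i}) \<union> uminus ` v ` ({..<n} - {i}))"
  shows "v i \<bullet> v i < 1"
proof (rule ccontr)
  define t where "t = v i \<bullet> v i"
  assume "\<not> v i \<bullet> v i < 1"
  then have "1 \<le> t"
    by (simp add: t_def)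
  have "t = t\<^sup>2 + (\<Sum>j\<in>{..<n} - {i}. (v j \<bullet> v i)\<^sup>2)"
    using uframe_sum_inner_square[OF assms(1), of "v i"] assms(2)
    by (simp add: sum.remove t_def)
  moreover have "t\<^sup>2 \<ge> t"
    using \<open>1 \<le> t\<close> by (simp add: power2_eq_square)
  ultimately have "(\<Sum>j\<in>{..<n} - {i}. (v j \<bullet> v i)\<^sup>2) = 0"
    using sum_nonneg[of "{..<n} - {i}" "\<lambda>j. (v j \<bullet> v i)\<^sup>2"] by simp
  then have "\<forall>j \<in> {..<n} - {i}. v i \<bullet> v j = 0"
    by (simp add: sum_nonneg_eq_0_iff inner_commute)
  then have "v i = 0"
    by (intro convex_hull_orthogonal_imp_zero[OF assms(3)]) auto
  with \<open>1 \<le> t\<close> show False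
    by (simp add: t_def)
qed

lemma uminus_mem_convex_hull_symmetric:
  fixes A :: "'a::real_vector set"
  assumes "x \<in> convex hull (A \<union> uminus ` A)"
  shows "- x \<in> convex hull (A \<union> uminus ` A)"
proof -
  have "uminus ` (A \<union> uminus ` A) = A \<union> uminus ` A"
    by (simp add: image_Un image_image Un_commute)
  with assms show ?thesis
    using convex_hull_linear_image[OF linear_uminus, of "A \<union> uminus ` A"] by auto
qed

lemma zero_mem_convex_hull_symmetric:
  fixes A :: "'a::real_vector set"
  assumes "x \<in> convex hull (A \<union> uminus ` A)"
  shows "0 \<in> convex hull (A \<union> uminus ` A)"
  using convexD[OF convex_convex_hull assms uminus_mem_convex_hull_symmetric[OF assms], of "1/2" "1/2"]
  by simp

lemma sym_hull_redundant:
  assumes "i < n" and "w i \<in> convex hull (w ` ({..<n} - {i}) \<union> uminus ` w ` ({..<n} - {i}))"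
  shows "sym_hull n w = convex hull (w ` ({..<n} - {i}) \<union> uminus ` w ` ({..<n} - {i}))"
proof -
  let ?R = "{..<n} - {i}"
  have "insert i ?R = {..<n}"
    using assms(1) by auto
  then have "w ` {..<n} \<union> (\<lambda>j. - w j) ` {..<n} = w ` insert i ?R \<union> (\<lambda>j. - w j) ` insert i ?R"
    by simp
  also have "\<dots> = insert (w i) (insert (- w i) (w ` ?R \<union> uminus ` w ` ?R))"
    by (simp only: image_insert image_image Un_insert_left Un_insert_right insert_commute)
  finally show ?thesis
    using assms(2) uminus_mem_convex_hull_symmetric[OF assms(2)]
    by (simp add: sym_hull_def hull_redundant)
qed

lemma sym_hull_fun_upd_zero:
  assumes "i < n" and "v i \<in> convex hull (v ` ({..<n} - {i}) \<union> uminus ` v ` ({..<n} - {i}))"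
  shows "sym_hull n (v(i := 0)) = sym_hull n v"
proof -
  have "(v(i := 0)) ` ({..<n} - {i}) = v ` ({..<n} - {i})"
    by simp
  moreover have "0 \<in> convex hull (v ` ({..<n} - {i}) \<union> uminus ` v ` ({..<n} - {i}))"
    using assms(2) by (rule zero_mem_convex_hull_symmetric)
  ultimately show ?thesis
    using sym_hull_redundant[OF assms(1), of "v(i := 0)"] sym_hull_redundant[OF assms] by simp
qed

lemma sym_hull_linear_image:
  assumes "linear f"
  shows "sym_hull n (\<lambda>j. f (w j)) = f ` sym_hull n w"
  unfolding sym_hull_def
  by (simp add: convex_hull_linear_image[OF assms] image_Un image_image linear_neg[OF assms])

lemma sym_hull_lmeasurable: "sym_hull n w \<in> lmeasurable"
  unfolding sym_hull_def by (intro lmeasurable_compact finite_imp_compact_convex_hull) simp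

lemma measure_sym_hull_pos:
  assumes "is_frame n w"
  shows "0 < measure lebesgue (sym_hull n w)"
proof -
  define K where "K = w ` {..<n} \<union> (\<lambda>j. - w j) ` {..<n}"
  have "K \<noteq> {}"
    using assms by (auto simp: K_def is_frame_def)
  then have "0 \<in> convex hull K"
    unfolding K_def
    by (metis image_image zero_mem_convex_hull_symmetric hull_subset ex_in_conv subsetD)
  then have "affine hull K = span K"
    by (intro affine_hull_span_0) (use convex_hull_subset_affine_hull in blast)
  moreover have "span (w ` {..<n}) \<subseteq> span K"
    by (rule span_mono) (auto simp: K_def)
  ultimately have "affine hull (convex hull K) = UNIV"
    using assms by (auto simp: is_frame_def)
  then have "interior (convex hull K) = rel_interior (convex hull K)"
    by (simp add: rel_interior_interior)
  also have "\<dots> \<noteq> {}"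
    using \<open>K \<noteq> {}\<close> by (simp add: rel_interior_eq_empty)
  finally have "interior (convex hull K) \<noteq> {}" .
  then have "\<not> negligible (sym_hull n w)"
    by (simp add: sym_hull_def K_def negligible_convex_interior)
  then have "measure lebesgue (sym_hull n w) \<noteq> 0"
    by (simp add: negligible_iff_measure0[OF sym_hull_lmeasurable])
  then show ?thesis
    using measure_nonneg[of lebesgue "sym_hull n w"] by linarith
qed

lemma measure_sym_hull_normalize_fun_upd_zero:
  assumes "is_uframe n v" "i < n"
    and "v i \<in> convex hull (v ` ({..<n} - {i}) \<union> uminus ` v ` ({..<n} - {i}))"
  shows "measure lebesgue (sym_hull n (normalize_frame n (v(i := 0))))
    = measure lebesgue (sym_hull n v) / sqrt (1 - v i \<bullet> v i)"
proof -
  define t where "t = v i \<bullet> v i"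
  \<comment> \<open>for \<open>t = 0\<close> this is \<open>0\<close> (division by zero), harmless since then \<open>v i = 0\<close>\<close>
  define c where "c = (1 / sqrt (1 - t) - 1) / t"
  have "0 \<le> t" "t < 1"
    using uframe_inner_self_less_one[OF assms] by (simp_all add: t_def)
  then have c: "1 + c * t = 1 / sqrt (1 - t)"
    by (cases "t = 0") (simp_all add: c_def)
  then have "B_frame n (v(i := 0)) = rank_one_update (v i) c"
    using inv_sqrt_mat_rank_one_update \<open>t < 1\<close>
    by (simp add: B_frame_def uframe_frame_op_fun_upd_zero[OF assms(1,2)] t_def)
  moreover have "sym_hull n (normalize_frame n (v(i := 0)))
      = (*v) (B_frame n (v(i := 0))) ` sym_hull n (v(i := 0))"
    unfolding normalize_frame_def by (rule sym_hull_linear_image[OF matrix_vector_mul_linear])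
  ultimately have "sym_hull n (normalize_frame n (v(i := 0))) = (*v) (rank_one_update (v i) c) ` sym_hull n v"
    using sym_hull_fun_upd_zero[OF assms(2,3)] by (simp only:)
  then show ?thesis
    using c \<open>t < 1\<close>
    by (simp add: measure_matrix_image sym_hull_lmeasurable det_rank_one_update t_def)
qed

theorem lemma6:
  fixes v :: "nat \<Rightarrow> real^'k" and n i :: nat
  assumes "is_uframe n v"
    and "i < n"
    and "v i \<in> convex hull ({v j | j. j < n \<and> j \<noteq> i} \<union> {- v j | j. j < n \<and> j \<noteq> i})"
  defines "St \<equiv> v(i := 0)"
  defines "S' \<equiv> normalize_frame n St"
  shows "measure lebesgue (sym_hull n v) \<le> measure lebesgue (sym_hull n S')
    \<and> (measure lebesgue (sym_hull n v) = measure lebesgue (sym_hull n S') \<longleftrightarrow> v i = 0)"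
proof -
  have "{j. j < n \<and> j \<noteq> i} = {..<n} - {i}"
    by auto
  then have others: "v i \<in> convex hull (v ` ({..<n} - {i}) \<union> uminus ` v ` ({..<n} - {i}))"
    using assms(3) by (simp add: setcompr_eq_image image_image)
  define s where "s = sqrt (1 - v i \<bullet> v i)"
  define m where "m = measure lebesgue (sym_hull n v)"
  have s: "0 < s" "s \<le> 1" "s = 1 \<longleftrightarrow> v i = 0"
    using uframe_inner_self_less_one[OF assms(1,2) others] by (auto simp: s_def)
  have "0 < m"
    using assms(1) by (simp add: is_uframe_def measure_sym_hull_pos m_def)
  then have "m \<le> m / s" "m = m / s \<longleftrightarrow> s = 1"
    using s(1,2) by (auto simp: le_divide_eq eq_divide_eq mult_cancel_left2)
  moreover have "measure lebesgue (sym_hull n S') = m / s"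
    unfolding S'_def St_def s_def m_def
    by (rule measure_sym_hull_normalize_fun_upd_zero[OF assms(1,2) others])
  ultimately show ?thesis
    unfolding m_def[symmetric] using s(3) by simp
qed

end
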